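(* Let $\mathcal{A}=\mathcal{A}^0\oplus\mathcal{A}^1$ be a finite-dimensional associative $\mathbb{Z}_2$-graded algebra over $\mathbb{F}$. Assume that $\mathcal{A}^0=\mathcal{S}+J$, where $\mathcal{S}$ is a semisimple subalgebra, $J=J(\mathcal{A}^0)$ is the Jacobson radical of $\mathcal{A}^0$, and $\mathcal{S}\cap J=0$. Then, for any $m\in\mathbb{N}$, $$G_m(\mathcal{A})=\mathcal{S}+(J+G_m^\ast(\mathcal{A})),$$ and $J+G_m^\ast(\mathcal{A})$ is the Jacobson radical of $G_m(\mathcal{A})$.
   Context: $\mathbb{F}$ is an algebraically closed field of characteristic zero; $\mathbb{N}=\{1,2,\dots\}$. $G_m$ is the unital Grassmann algebra over $\mathbb{F}$ generated by $e_1,\dots,e_m$ (with $e_ie_j=-e_je_i$, $e_i^2=0$), and $G_m^\ast$ is the corresponding Grassmann algebra without unity (the span of the monomials of positive length). Both decompose as $G_m=(G_m)^0\oplus(G_m)^1$ and $G_m^\ast=(G_m^\ast)^0\oplus(G_m^\ast)^1$, the sums of the spans of monomials of even, respectively odd, length. For a $\mathbb{Z}_2$-graded algebra $\mathcal{A}=\mathcal{A}^0\oplus\mathcal{A}^1$ put $G_m(\mathcal{A})=(G_m)^0\otimes\mathcal{A}^0\oplus(G_m)^1\otimes\mathcal{A}^1$ and $G_m^\ast(\mathcal{A})=(G_m^\ast)^0\otimes\mathcal{A}^0\oplus(G_m^\ast)^1\otimes\mathcal{A}^1$, as subalgebras of $G_m\otimes\mathcal{A}$. The algebra $\mathcal{A}^0$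 is identified with $1\otimes\mathcal{A}^0\subseteq G_m(\mathcal{A})$. *)

theory Defs
  imports "HOL-Computational_Algebra.Polynomial" "HOL-Library.Set_Algebras"
begin

section \<open>Associative algebras and the Jacobson radical\<close>

text \<open>Algebras are associative but not assumed to be unital. The ambient algebra is a type of
  class \<open>ring\<close>; subalgebras and ideals are subsets of it.\<close>

locale assoc_algebra = vector_space scale
  for scale :: "'f::field \<Rightarrow> 'a::ring \<Rightarrow> 'a" +
  assumes scale_mult_left: "scale c (x * y) = scale c x * y"
    and scale_mult_right: "scale c (x * y) = x * scale c y"

definition finite_dimensional :: "('f::field \<Rightarrow> 'a::ab_group_add \<Rightarrow> 'a) \<Rightarrow> bool"
  where "finite_dimensional scale \<longleftrightarrow> (\<exists>B. finite B \<and> module.span scale B = UNIV)"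

definition subalgebra :: "('f::field \<Rightarrow> 'a::ring \<Rightarrow> 'a) \<Rightarrow> 'a set \<Rightarrow> bool"
  where "subalgebra scale B \<longleftrightarrow> module.subspace scale B \<and> B * B \<subseteq> B"

definition z2_grading :: "('f::field \<Rightarrow> 'a::ring \<Rightarrow> 'a) \<Rightarrow> 'a set \<Rightarrow> 'a set \<Rightarrow> bool"
  where "z2_grading scale A0 A1 \<longleftrightarrow>
    module.subspace scale A0 \<and> module.subspace scale A1 \<and>
    A0 + A1 = UNIV \<and> A0 \<inter> A1 = {0} \<and>
    A0 * A0 \<subseteq> A0 \<and> A0 * A1 \<subseteq> A1 \<and> A1 * A0 \<subseteq> A1 \<and> A1 * A1 \<subseteq> A0"

definition left_ideal :: "('f::field \<Rightarrow> 'a::ring \<Rightarrow> 'a) \<Rightarrow> 'a set \<Rightarrow> 'a set \<Rightarrow> bool"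
  where "left_ideal scale B I \<longleftrightarrow> module.subspace scale I \<and> I \<subseteq> B \<and> B * I \<subseteq> I"

definition maximal_left_ideal :: "('f::field \<Rightarrow> 'a::ring \<Rightarrow> 'a) \<Rightarrow> 'a set \<Rightarrow> 'a set \<Rightarrow> bool"
  where "maximal_left_ideal scale B I \<longleftrightarrow>
    left_ideal scale B I \<and> I \<noteq> B \<and> (\<forall>K. left_ideal scale B K \<and> I \<subseteq> K \<longrightarrow> K = I \<or> K = B)"

definition modular :: "'a::ring set \<Rightarrow> 'a set \<Rightarrow> bool"
  where "modular B I \<longleftrightarrow> (\<exists>e\<in>B. \<forall>b\<in>B. b - b * e \<in> I)"

text \<open>The Jacobson radical of a possibly non-unital algebra is the intersection of its maximal
  modular (also called regular) left ideals, and the whole algebra if there are none. Over a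
  unital algebra every left ideal is modular, see \<open>jacobson_radical_unital\<close>.\<close>

definition jacobson_radical :: "('f::field \<Rightarrow> 'a::ring \<Rightarrow> 'a) \<Rightarrow> 'a set \<Rightarrow> 'a set"
  where "jacobson_radical scale B =
    B \<inter> \<Inter>{I. maximal_left_ideal scale B I \<and> modular B I}"

lemma (in assoc_algebra) jacobson_radical_unital:
  assumes "u \<in> B" "\<And>b. b \<in> B \<Longrightarrow> b * u = b"
  shows "jacobson_radical scale B = B \<inter> \<Inter>{I. maximal_left_ideal scale B I}"
proof -
  have "modular B I" if "maximal_left_ideal scale B I" for I
    using that assms subspace_0
    by (auto simp: modular_def maximal_left_ideal_def left_ideal_def intro!: bexI[of _ u])
  then show ?thesis
    unfolding jacobson_radical_def by blast
qed

text \<open>A finite-dimensional algebra is semisimple if its Jacobson radical is zero.\<close>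

definition semisimple_subalgebra :: "('f::field \<Rightarrow> 'a::ring \<Rightarrow> 'a) \<Rightarrow> 'a set \<Rightarrow> bool"
  where "semisimple_subalgebra scale S \<longleftrightarrow> subalgebra scale S \<and> jacobson_radical scale S = {0}"


section \<open>Grassmann algebras\<close>

text \<open>An element of \<open>'a grassmann\<close> is a finite sum of terms \<open>e\<^sub>I \<otimes> a\<^sub>I\<close>, where \<open>I\<close> is a finite set
  of natural numbers, \<open>e\<^sub>I\<close> is the product of the generators \<open>e\<^sub>i\<close>, \<open>i \<in> I\<close>, in increasing order,
  and \<open>a\<^sub>I\<close> is in \<open>'a\<close>. So \<open>'f grassmann\<close> is the unital Grassmann algebra over \<open>'f\<close> on countably
  many generators, and \<open>'a grassmann\<close> is its tensor product with \<open>'a\<close>. The lemmas below confirm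
  the defining relations, the linear independence of the \<open>e\<^sub>I\<close>, and the universal property of the
  tensor product.\<close>

typedef (overloaded) 'a grassmann =
    "{x :: nat set \<Rightarrow> 'a::zero. finite {I. x I \<noteq> 0} \<and> (\<forall>I. x I \<noteq> 0 \<longrightarrow> finite I)}"
  morphisms coeff Abs_grassmann
  by (rule exI[of _ "\<lambda>_. 0"]) simp

setup_lifting type_definition_grassmann

hide_const (open) coeff

abbreviation gcoeff :: "'a::zero grassmann \<Rightarrow> nat set \<Rightarrow> 'a"
  where "gcoeff \<equiv> Defs.coeff"

lemma grassmann_eqI: "(\<And>I. gcoeff x I = gcoeff y I) \<Longrightarrow> x = y"
  by transfer auto

lemma finite_gcoeff: "finite {I. gcoeff x I \<noteq> 0}"
  by transfer simp

lemma gcoeff_infinite: "infinite I \<Longrightarrow> gcoeff x I = 0"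
  by transfer auto

text \<open>\<open>e\<^sub>I e\<^sub>J = (-1)\<^bsup>k\<^esup> e\<^bsub>I \<union> J\<^esub>\<close> for disjoint \<open>I\<close>, \<open>J\<close>, where \<open>k\<close> is the number of inversions
  between \<open>I\<close> and \<open>J\<close>.\<close>

definition inversions :: "nat set \<Rightarrow> nat set \<Rightarrow> nat"
  where "inversions I J = card {(i, j). i \<in> I \<and> j \<in> J \<and> j < i}"

definition signed :: "nat \<Rightarrow> 'a::group_add \<Rightarrow> 'a"
  where "signed k a = (if even k then a else - a)"

lemma signed_simps [simp]:
  "signed 0 a = a" "signed k 0 = 0" "signed k a = 0 \<longleftrightarrow> a = 0"
  "signed k (signed l a) = signed (k + l) a"
  by (auto simp: signed_def)

lemma signed_add: "signed k (a + b) = signed k a + signed k (b :: 'a::ab_group_add)"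
  by (simp add: signed_def)

lemma signed_mult: "signed k a * b = signed k (a * b)" "a * signed k b = signed k (a * (b::'a::ring))"
  by (auto simp: signed_def)

lemma signed_sum: "signed k (sum f S) = (\<Sum>x\<in>S. signed k (f x :: 'a::ab_group_add))"
  by (simp add: signed_def sum_negf)

lemma inversions_finite:
  "finite I \<Longrightarrow> finite J \<Longrightarrow> finite {(i, j). i \<in> I \<and> j \<in> J \<and> j < (i::nat)}"
  by (rule finite_subset[of _ "I \<times> J"]) auto

lemma inversions_empty [simp]: "inversions {} J = 0" "inversions I {} = 0"
  by (auto simp: inversions_def)

lemma inversions_Un_left:
  assumes "finite I" "finite I'" "finite J" "I \<inter> I' = {}"
  shows "inversions (I \<union> I') J = inversions I J + inversions I' J"
proof -
  have "{(i, j). i \<in> I \<union> I' \<and> j \<in> J \<and> j < i} =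
      {(i, j). i \<in> I \<and> j \<in> J \<and> j < i} \<union> {(i, j). i \<in> I' \<and> j \<in> J \<and> j < i}" by auto
  then show ?thesis
    unfolding inversions_def using assms
    by (auto intro!: card_Un_disjoint inversions_finite)
qed

lemma inversions_Un_right:
  assumes "finite I" "finite J'" "finite J" "J \<inter> J' = {}"
  shows "inversions I (J \<union> J') = inversions I J + inversions I J'"
proof -
  have "{(i, j). i \<in> I \<and> j \<in> J \<union> J' \<and> j < i} =
      {(i, j). i \<in> I \<and> j \<in> J \<and> j < i} \<union> {(i, j). i \<in> I \<and> j \<in> J' \<and> j < i}" by auto
  then show ?thesis
    unfolding inversions_def using assms
    by (auto intro!: card_Un_disjoint inversions_finite)
qed

lemma grassmann_mult_closed:
  fixes x y :: "nat set \<Rightarrow> 'a::ring"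
  assumes "finite {I. x I \<noteq> 0}" "finite {I. y I \<noteq> 0}"
  shows "finite {K. (\<Sum>I\<in>Pow K. signed (inversions I (K - I)) (x I * y (K - I))) \<noteq> 0}"
proof (rule finite_subset)
  show "{K. (\<Sum>I\<in>Pow K. signed (inversions I (K - I)) (x I * y (K - I))) \<noteq> 0}
      \<subseteq> (\<lambda>(I, J). I \<union> J) ` ({I. x I \<noteq> 0} \<times> {I. y I \<noteq> 0})"
  proof
    fix K
    assume "K \<in> {K. (\<Sum>I\<in>Pow K. signed (inversions I (K - I)) (x I * y (K - I))) \<noteq> 0}"
    then obtain I where "I \<subseteq> K" "x I * y (K - I) \<noteq> 0"
      using sum.not_neutral_contains_not_neutral by force
    then show "K \<in> (\<lambda>(I, J). I \<union> J) ` ({I. x I \<noteq> 0} \<times> {I. y I \<noteq> 0})"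
      by (intro image_eqI[of _ _ "(I, K - I)"]) auto
  qed
qed (use assms in auto)

instantiation grassmann :: (ab_group_add) ab_group_add
begin

lift_definition zero_grassmann :: "'a grassmann" is "\<lambda>_. 0"
  by simp

lift_definition plus_grassmann :: "'a grassmann \<Rightarrow> 'a grassmann \<Rightarrow> 'a grassmann"
  is "\<lambda>x y I. x I + y I"
proof -
  fix x y :: "nat set \<Rightarrow> 'a"
  assume *: "finite {I. x I \<noteq> 0} \<and> (\<forall>I. x I \<noteq> 0 \<longrightarrow> finite I)"
    "finite {I. y I \<noteq> 0} \<and> (\<forall>I. y I \<noteq> 0 \<longrightarrow> finite I)"
  have "{I. x I + y I \<noteq> 0} \<subseteq> {I. x I \<noteq> 0} \<union> {I. y I \<noteq> 0}" by auto
  then have "finite {I. x I + y I \<noteq> 0}"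
    using * by (meson finite_UnI finite_subset)
  moreover have "finite I" if "x I + y I \<noteq> 0" for I
    using * that by (cases "x I = 0") auto
  ultimately show "finite {I. x I + y I \<noteq> 0} \<and> (\<forall>I. x I + y I \<noteq> 0 \<longrightarrow> finite I)"
    by blast
qed

lift_definition uminus_grassmann :: "'a grassmann \<Rightarrow> 'a grassmann" is "\<lambda>x I. - x I"
  by simp

definition minus_grassmann :: "'a grassmann \<Rightarrow> 'a grassmann \<Rightarrow> 'a grassmann"
  where "minus_grassmann x y = x + - y"

instance
proof
  fix x y z :: "'a grassmann"
  show "x + y + z = x + (y + z)" by transfer (simp add: add.assoc)
  show "x + y = y + x" by transfer (simp add: add.commute)
  show "0 + x = x" by transfer simp
  show "- x + x = 0" by transfer simp
  show "x - y = x + - y" by (simp add: minus_grassmann_def)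
qed

end

lemma gcoeff_simps [simp]:
  fixes x y :: "'a::ab_group_add grassmann"
  shows "gcoeff (0 :: 'a grassmann) I = 0" "gcoeff (x + y) I = gcoeff x I + gcoeff y I"
    "gcoeff (- y) I = - gcoeff y I" "gcoeff (x - y) I = gcoeff x I - gcoeff y I"
proof -
  show plus: "gcoeff (x + y) I = gcoeff x I + gcoeff y I" and
    uminus: "gcoeff (- y) I = - gcoeff y I" for x y :: "'a grassmann"
    by (simp_all add: plus_grassmann.rep_eq uminus_grassmann.rep_eq)
  show "gcoeff (x - y) I = gcoeff x I - gcoeff y I"
    unfolding minus_grassmann_def plus uminus by simp
qed (simp add: zero_grassmann.rep_eq)

lemma gcoeff_sum [simp]: "gcoeff (sum f S) I = (\<Sum>x\<in>S. gcoeff (f x) I)"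
  by (induction S rule: infinite_finite_induct) auto

instantiation grassmann :: (ring) ring
begin

lift_definition times_grassmann :: "'a grassmann \<Rightarrow> 'a grassmann \<Rightarrow> 'a grassmann"
  is "\<lambda>x y K. \<Sum>I\<in>Pow K. signed (inversions I (K - I)) (x I * y (K - I))"
proof (intro conjI allI impI)
  fix x y :: "nat set \<Rightarrow> 'a" and K
  assume "(\<Sum>I\<in>Pow K. signed (inversions I (K - I)) (x I * y (K - I))) \<noteq> 0"
  then show "finite K"
    by (metis finite_Pow_iff sum.infinite)
qed (blast intro: grassmann_mult_closed)

instance
proof
  fix x y z :: "'a grassmann"
  show "(x + y) * z = x * z + y * z"
    by transfer (simp add: distrib_right signed_add sum.distrib fun_eq_iff)
  show "x * (y + z) = x * y + x * z"
    by transfer (simp add: distrib_left signed_add sum.distrib fun_eq_iff)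
  show "x * y * z = x * (y * z)"
  proof (rule grassmann_eqI)
    fix K
    show "gcoeff (x * y * z) K = gcoeff (x * (y * z)) K"
    proof (cases "finite K")
      case False
      then show ?thesis by (simp add: gcoeff_infinite)
    next
      case K: True
      let ?t = "\<lambda>I J L. signed (inversions I J + inversions I L + inversions J L)
        (gcoeff x I * gcoeff y J * gcoeff z L)"
      have fin: "finite I" if "I \<subseteq> K" for I using that K finite_subset by blast
      have "gcoeff (x * y * z) K = (\<Sum>M\<in>Pow K. \<Sum>I\<in>Pow M. ?t I (M - I) (K - M))"
        unfolding times_grassmann.rep_eq sum_distrib_right signed_sum signed_mult
      proof (intro sum.cong refl)
        fix M I assume *: "M \<in> Pow K" "I \<in> Pow M"
        have "inversions M (K - M) = inversions I (K - M) + inversions (M - I) (K - M)"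
          using inversions_Un_left[of I "M - I" "K - M"] * fin
          by (metis Diff_disjoint Diff_partition Diff_subset PowD order_trans)
        then show "signed (inversions M (K - M)) (signed (inversions I (M - I))
            (gcoeff x I * gcoeff y (M - I) * gcoeff z (K - M))) = ?t I (M - I) (K - M)"
          by (simp add: algebra_simps)
      qed
      also have "\<dots> = (\<Sum>(M, I)\<in>Sigma (Pow K) Pow. ?t I (M - I) (K - M))"
        using K fin by (intro sum.Sigma) auto
      also have "\<dots> = (\<Sum>(I, J)\<in>Sigma (Pow K) (\<lambda>I. Pow (K - I)). ?t I J (K - I - J))"
        by (rule sum.reindex_bij_witness[where i = "\<lambda>(I, J). (I \<union> J, I)"
              and j = "\<lambda>(M, I). (I, M - I)"])
          (auto simp: Un_absorb1 Diff_eq Int_ac intro!: arg_cong2[where f = signed]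
            arg_cong2[where f = times] arg_cong2[where f = plus]
            arg_cong2[where f = inversions] arg_cong[where f = "gcoeff z"])
      also have "\<dots> = (\<Sum>I\<in>Pow K. \<Sum>J\<in>Pow (K - I). ?t I J (K - I - J))"
        using K by (intro sum.Sigma[symmetric]) auto
      also have "\<dots> = gcoeff (x * (y * z)) K"
        unfolding times_grassmann.rep_eq sum_distrib_left signed_sum signed_mult
      proof (intro sum.cong refl)
        fix I J assume *: "I \<in> Pow K" "J \<in> Pow (K - I)"
        then have "inversions I (K - I) = inversions I J + inversions I (K - I - J)"
          using inversions_Un_right[of I "K - I - J" J] fin
          by (metis Diff_disjoint Diff_partition Diff_subset PowD order_trans)
        then show "?t I J (K - I - J) = signed (inversions I (K - I))
            (signed (inversions J (K - I - J)) (gcoeff x I * (gcoeff y J * gcoeff z (K - I - J))))"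
          by (simp add: algebra_simps)
      qed
      finally show ?thesis .
    qed
  qed
qed

end

lift_definition gterm :: "nat set \<Rightarrow> 'a::zero \<Rightarrow> 'a grassmann"
  is "\<lambda>I a J. if J = I \<and> finite I then a else 0"
  by (auto intro: finite_subset[of _ "{_}"])

lemma gcoeff_gterm: "gcoeff (gterm I a) J = (if J = I \<and> finite I then a else 0)"
  by transfer simp

lemma gterm_add: "gterm I (a + b) = gterm I a + gterm I (b :: 'a::ab_group_add)"
  by (rule grassmann_eqI) (simp add: gcoeff_gterm)

lemma gterm_zero [simp]: "gterm I 0 = (0 :: 'a::ab_group_add grassmann)"
  by (rule grassmann_eqI) (simp add: gcoeff_gterm)

lemma grassmann_expansion:
  "(x :: 'a::ab_group_add grassmann) = (\<Sum>I | gcoeff x I \<noteq> 0. gterm I (gcoeff x I))"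
proof (rule grassmann_eqI)
  fix J
  have "gcoeff (gterm I (gcoeff x I)) J = (if I = J then gcoeff x I else 0)" for I
    by (cases "finite I") (auto simp: gcoeff_gterm gcoeff_infinite)
  then have "gcoeff (\<Sum>I | gcoeff x I \<noteq> 0. gterm I (gcoeff x I)) J =
      (\<Sum>I | gcoeff x I \<noteq> 0. if I = J then gcoeff x I else 0)"
    by simp
  also have "\<dots> = gcoeff x J"
    by (subst sum.delta) (simp_all add: finite_gcoeff)
  finally show "gcoeff x J = gcoeff (\<Sum>I | gcoeff x I \<noteq> 0. gterm I (gcoeff x I)) J" ..
qed

lemma gterm_mult:
  assumes "finite I" "finite J"
  shows "gterm I a * gterm J b =
    (if I \<inter> J = {} then gterm (I \<union> J) (signed (inversions I J) (a * b)) else 0)"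
proof (rule grassmann_eqI)
  fix K
  have "gcoeff (gterm I a * gterm J b) K = (\<Sum>L\<in>Pow K. if L = I then
      (if K - I = J then signed (inversions I J) (a * b) else 0) else 0)"
    unfolding times_grassmann.rep_eq
    by (intro sum.cong) (use assms in \<open>auto simp: gcoeff_gterm\<close>)
  also have "\<dots> = (if I \<subseteq> K \<and> K - I = J then signed (inversions I J) (a * b) else 0)"
    using assms by (cases "finite K") (auto simp: finite_Diff2)
  also have "\<dots> = gcoeff (if I \<inter> J = {} then gterm (I \<union> J) (signed (inversions I J) (a * b)) else 0) K"
    using assms by (auto simp: gcoeff_gterm)
  finally show "gcoeff (gterm I a * gterm J b) K =
    gcoeff (if I \<inter> J = {} then gterm (I \<union> J) (signed (inversions I J) (a * b)) else 0) K" .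
qed

instantiation grassmann :: (ring_1) ring_1
begin

definition one_grassmann :: "'a grassmann"
  where "one_grassmann = gterm {} 1"

instance
proof
  fix x :: "'a grassmann"
  have "1 * gterm I a = gterm I a \<and> gterm I a * 1 = gterm I a" for I and a :: 'a
  proof (cases "finite I")
    case True
    then show ?thesis by (simp add: one_grassmann_def gterm_mult)
  next
    case False
    then have "gterm I a = 0" by (intro grassmann_eqI) (simp add: gcoeff_gterm)
    then show ?thesis by simp
  qed
  then have "1 * (\<Sum>I\<in>T. gterm I (f I)) = (\<Sum>I\<in>T. gterm I (f I))"
    "(\<Sum>I\<in>T. gterm I (f I)) * 1 = (\<Sum>I\<in>T. gterm I (f I))" for T and f :: "nat set \<Rightarrow> 'a"
    by (simp_all add: sum_distrib_left sum_distrib_right)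
  then show "1 * x = x" "x * 1 = x"
    by (subst (1 2) grassmann_expansion[of x]; blast)+
  show "(0 :: 'a grassmann) \<noteq> 1"
  proof
    assume "(0 :: 'a grassmann) = 1"
    then have "gcoeff (0 :: 'a grassmann) {} = gcoeff (gterm {} 1) {}"
      by (simp add: one_grassmann_def)
    then show False by (simp add: gcoeff_gterm)
  qed
qed

end

definition gen :: "nat \<Rightarrow> 'a::ring_1 grassmann"
  where "gen i = gterm {i} 1"

lemma gen_square: "gen i * gen i = 0"
  by (simp add: gen_def gterm_mult)

lemma gen_anticommute: "gen i * gen j = - (gen j * gen i :: 'a::ring_1 grassmann)"
proof (cases "i = j")
  case True
  then show ?thesis by (simp add: gen_square)
next
  case False
  have *: "inversions {k} {l} = (if l < k then 1 else 0)" for k l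
  proof -
    have "{(i, j). i \<in> {k} \<and> j \<in> {l} \<and> j < i} = (if l < k then {(k, l)} else {})" by auto
    then show ?thesis by (simp add: inversions_def)
  qed
  from False show ?thesis
    by (intro grassmann_eqI) (auto simp: gen_def gterm_mult * signed_def gcoeff_gterm insert_commute)
qed

lemma prod_gen_sorted:
  "sorted_wrt (<) is \<Longrightarrow> prod_list (map gen is) = (gterm (set is) 1 :: 'a::ring_1 grassmann)"
proof (induction "is")
  case Nil
  then show ?case by (simp add: one_grassmann_def)
next
  case (Cons i "is")
  have "{(k, l). k \<in> {i} \<and> l \<in> set is \<and> l < k} = {}" using Cons.prems by force
  then have "inversions {i} (set is) = 0" by (simp only: inversions_def card.empty)
  moreover have "i \<notin> set is" using Cons.prems by auto
  ultimately show ?case using Cons by (simp add: gen_def gterm_mult)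
qed


section \<open>Tensor products\<close>

text \<open>In the next two definitions the case distinction only serves to make the functions total:
  for a vector space, \<open>scale c 0\<close> and \<open>scale 0 a\<close> are zero anyway.\<close>

lift_definition gscale :: "('f \<Rightarrow> 'a \<Rightarrow> 'a) \<Rightarrow> 'f::field \<Rightarrow> 'a::ab_group_add grassmann \<Rightarrow> 'a grassmann"
  is "\<lambda>scale c x I. if x I = 0 then 0 else scale c (x I)"
  by (auto elim: rev_finite_subset)

lift_definition gtensor :: "('f \<Rightarrow> 'a \<Rightarrow> 'a) \<Rightarrow> 'f::field grassmann \<Rightarrow> 'a::ab_group_add \<Rightarrow> 'a grassmann"
  is "\<lambda>scale g a I. if g I = 0 then 0 else scale (g I) a"
  by (auto elim: rev_finite_subset)

context vector_space
begin

lemma gcoeff_gscale: "gcoeff (gscale scale c x) I = scale c (gcoeff x I)"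
  by (simp add: gscale.rep_eq)

lemma gcoeff_gtensor: "gcoeff (gtensor scale g a) I = scale (gcoeff g I) a"
  by (simp add: gtensor.rep_eq)

lemma vector_space_gscale: "vector_space (gscale scale)"
  by unfold_locales
    (auto intro!: grassmann_eqI simp: gcoeff_gscale scale_right_distrib scale_left_distrib)

lemma linear_gtensor_right: "Vector_Spaces.linear scale (gscale scale) (gtensor scale g)"
  using vector_space_gscale vector_space_axioms
  by (auto simp: Vector_Spaces.linear_iff intro!: grassmann_eqI
      simp: gcoeff_gscale gcoeff_gtensor scale_right_distrib mult.commute)

end

lemma vector_space_field: "vector_space ((*) :: 'f::field \<Rightarrow> 'f \<Rightarrow> 'f)"
  by unfold_locales (auto simp: algebra_simps)

abbreviation fscale :: "'f::field \<Rightarrow> 'f grassmann \<Rightarrow> 'f grassmann"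
  where "fscale \<equiv> gscale (*)"

lemma (in vector_space) linear_gtensor_left: "Vector_Spaces.linear fscale (gscale scale) (\<lambda>g. gtensor scale g a)"
  using vector_space_gscale vector_space.vector_space_gscale[OF vector_space_field]
  by (auto simp: Vector_Spaces.linear_iff intro!: grassmann_eqI
      simp: gcoeff_gscale gcoeff_gtensor scale_left_distrib
        vector_space.gcoeff_gscale[OF vector_space_field])

lemma (in vector_space) gterm_conv_gtensor: "gterm I a = gtensor scale (gterm I 1) a"
  by (rule grassmann_eqI) (simp add: gcoeff_gtensor gcoeff_gterm)

context assoc_algebra
begin

lemma assoc_algebra_gscale: "assoc_algebra (gscale scale)"
proof -
  interpret G: vector_space "gscale scale" by (rule vector_space_gscale)
  have [simp]: "scale c (signed k a) = signed k (scale c a)" for c k a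
    by (simp add: signed_def)
  show ?thesis
  proof
    fix c x y
    show "gscale scale c (x * y) = gscale scale c x * y"
      by (rule grassmann_eqI)
        (simp add: gcoeff_gscale times_grassmann.rep_eq scale_sum_right scale_mult_left)
    show "gscale scale c (x * y) = x * gscale scale c y"
      by (rule grassmann_eqI)
        (simp add: gcoeff_gscale times_grassmann.rep_eq scale_sum_right scale_mult_right)
  qed
qed

theorem gtensor_mult:
  "gtensor scale g a * gtensor scale h b = gtensor scale (g * h) (a * b)"
proof (rule grassmann_eqI)
  fix K
  have "scale c a * scale d b = scale (c * d) (a * b)" for c d
    by (metis scale_mult_left scale_mult_right scale_scale)
  moreover have "signed k (scale c x) = scale (signed k c) x" for k c x
    by (simp add: signed_def)
  ultimately show "gcoeff (gtensor scale g a * gtensor scale h b) K =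
      gcoeff (gtensor scale (g * h) (a * b)) K"
    by (simp add: times_grassmann.rep_eq gcoeff_gtensor scale_sum_left)
qed

end

theorem (in vector_space) gtensor_universal:
  fixes scaleW :: "'a \<Rightarrow> 'w::ab_group_add \<Rightarrow> 'w"
  assumes right: "\<And>g. Vector_Spaces.linear scale scaleW (\<beta> g)"
    and left: "\<And>a. Vector_Spaces.linear fscale scaleW (\<lambda>g. \<beta> g a)"
  shows "\<exists>!\<phi>. Vector_Spaces.linear (gscale scale) scaleW \<phi> \<and> (\<forall>g a. \<phi> (gtensor scale g a) = \<beta> g a)"
proof -
  interpret W: vector_space scaleW
    using right unfolding Vector_Spaces.linear_iff by blast
  interpret F: vector_space "(*) :: 'a \<Rightarrow> 'a \<Rightarrow> 'a" by (rule vector_space_field)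
  note vs = vector_space_gscale F.vector_space_gscale W.vector_space_axioms
  have \<beta>r [simp]: "\<beta> g (a + b) = \<beta> g a + \<beta> g b" "\<beta> g (scale c a) = scaleW c (\<beta> g a)" for g a b c
    using right[of g] unfolding Vector_Spaces.linear_iff by auto
  have \<beta>l [simp]: "\<beta> (g + h) a = \<beta> g a + \<beta> h a" "\<beta> (fscale c g) a = scaleW c (\<beta> g a)" for g h a c
    using left[of a] unfolding Vector_Spaces.linear_iff by auto
  have \<beta>0 [simp]: "\<beta> g 0 = 0" "\<beta> 0 a = 0" for g a
    using \<beta>r(1)[of g 0 0] \<beta>l(1)[of 0 0 a] by auto
  have \<beta>sum: "\<beta> (sum f S) a = (\<Sum>x\<in>S. \<beta> (f x) a)" for f :: "nat set \<Rightarrow> _" and S a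
    by (induction S rule: infinite_finite_induct) auto
  define \<phi> where "\<phi> x = (\<Sum>I | gcoeff x I \<noteq> 0. \<beta> (gterm I 1) (gcoeff x I))" for x
  have \<phi>: "\<phi> x = (\<Sum>I\<in>S. \<beta> (gterm I 1) (gcoeff x I))"
    if "finite S" "{I. gcoeff x I \<noteq> 0} \<subseteq> S" for x S
    unfolding \<phi>_def using that by (intro sum.mono_neutral_left) auto
  have add: "\<phi> (x + y) = \<phi> x + \<phi> y" for x y
  proof -
    let ?S = "{I. gcoeff x I \<noteq> 0} \<union> {I. gcoeff y I \<noteq> 0}"
    have S: "finite ?S" by (simp add: finite_gcoeff)
    show ?thesis
      by (subst (1 2 3) \<phi>[OF S]) (auto simp: sum.distrib)
  qed
  have scl: "\<phi> (gscale scale c x) = scaleW c (\<phi> x)" for c x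
    by (subst (1 2) \<phi>[OF finite_gcoeff[of x]]) (auto simp: gcoeff_gscale W.scale_sum_right)
  have lin: "Vector_Spaces.linear (gscale scale) scaleW \<phi>"
    using vs add scl by (simp add: Vector_Spaces.linear_iff)
  have ten: "\<phi> (gtensor scale g a) = \<beta> g a" for g a
  proof -
    have "\<beta> g a = (\<Sum>I | gcoeff g I \<noteq> 0. \<beta> (gterm I (gcoeff g I)) a)"
      by (subst grassmann_expansion[of g]) (rule \<beta>sum)
    also have "\<dots> = (\<Sum>I | gcoeff g I \<noteq> 0. scaleW (gcoeff g I) (\<beta> (gterm I 1) a))"
    proof (intro sum.cong refl)
      fix I
      have "gterm I (gcoeff g I) = fscale (gcoeff g I) (gterm I 1)"
        by (rule grassmann_eqI) (simp add: gcoeff_gterm F.gcoeff_gscale)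
      then show "\<beta> (gterm I (gcoeff g I)) a = scaleW (gcoeff g I) (\<beta> (gterm I 1) a)" by simp
    qed
    also have "\<dots> = \<phi> (gtensor scale g a)"
      by (subst \<phi>[OF finite_gcoeff[of g]]) (auto simp: gcoeff_gtensor)
    finally show ?thesis by simp
  qed
  have uniq: "\<psi> x = \<phi> x"
    if "Vector_Spaces.linear (gscale scale) scaleW \<psi>" "\<forall>g a. \<psi> (gtensor scale g a) = \<beta> g a" for \<psi> x
  proof -
    have "\<psi> (gterm I a) = \<phi> (gterm I a)" for I a
      using that(2) ten by (simp add: gterm_conv_gtensor)
    moreover have "\<psi> (\<Sum>I\<in>S. gterm I (f I)) = (\<Sum>I\<in>S. \<psi> (gterm I (f I)))"
      "\<phi> (\<Sum>I\<in>S. gterm I (f I)) = (\<Sum>I\<in>S. \<phi> (gterm I (f I)))" for f S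
      using Vector_Spaces.linear.axioms(3) module_hom.sum that(1) lin by blast+
    ultimately have "\<psi> (\<Sum>I\<in>S. gterm I (f I)) = \<phi> (\<Sum>I\<in>S. gterm I (f I))" for f S
      by simp
    then show ?thesis by (subst (1 2) grassmann_expansion[of x])
  qed
  show ?thesis
  proof (rule ex1I[of _ \<phi>])
    show "Vector_Spaces.linear (gscale scale) scaleW \<phi> \<and> (\<forall>g a. \<phi> (gtensor scale g a) = \<beta> g a)"
      using lin ten by blast
  next
    fix \<psi>
    assume "Vector_Spaces.linear (gscale scale) scaleW \<psi> \<and> (\<forall>g a. \<psi> (gtensor scale g a) = \<beta> g a)"
    then have "\<psi> x = \<phi> x" for x by (intro uniq) simp_all
    then show "\<psi> = \<phi>" by (rule ext)
  qed
qed


section \<open>Grassmann envelopes\<close>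

text \<open>\<open>G\<^sub>m\<close> is the subalgebra of \<open>'f grassmann\<close> generated by \<open>1\<close> and \<open>gen 1, \<dots>, gen m\<close>. Words with
  repeated letters are zero, so they do not affect the spans.\<close>

definition G_even :: "nat \<Rightarrow> 'f::field grassmann set"
  where "G_even m = module.span fscale
    {prod_list (map gen is) | is. set is \<subseteq> {1..m} \<and> even (length is)}"

definition G_odd :: "nat \<Rightarrow> 'f::field grassmann set"
  where "G_odd m = module.span fscale
    {prod_list (map gen is) | is. set is \<subseteq> {1..m} \<and> odd (length is)}"

definition Gstar_even :: "nat \<Rightarrow> 'f::field grassmann set"
  where "Gstar_even m = module.span fscale
    {prod_list (map gen is) | is. set is \<subseteq> {1..m} \<and> length is > 0 \<and> even (length is)}"

definition Gstar_odd :: "nat \<Rightarrow> 'f::field grassmann set"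
  where "Gstar_odd m = module.span fscale
    {prod_list (map gen is) | is. set is \<subseteq> {1..m} \<and> length is > 0 \<and> odd (length is)}"

definition tensor_space ::
    "('f::field \<Rightarrow> 'a::ab_group_add \<Rightarrow> 'a) \<Rightarrow> 'f grassmann set \<Rightarrow> 'a set \<Rightarrow> 'a grassmann set"
  where "tensor_space scale X B = module.span (gscale scale) {gtensor scale g a | g a. g \<in> X \<and> a \<in> B}"

definition G_env ::
    "('f::field \<Rightarrow> 'a::ab_group_add \<Rightarrow> 'a) \<Rightarrow> 'a set \<Rightarrow> 'a set \<Rightarrow> nat \<Rightarrow> 'a grassmann set"
  where "G_env scale A0 A1 m =
    tensor_space scale (G_even m) A0 + tensor_space scale (G_odd m) A1"

definition Gstar_env ::
    "('f::field \<Rightarrow> 'a::ab_group_add \<Rightarrow> 'a) \<Rightarrow> 'a set \<Rightarrow> 'a set \<Rightarrow> nat \<Rightarrow> 'a grassmann set"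
  where "Gstar_env scale A0 A1 m =
    tensor_space scale (Gstar_even m) A0 + tensor_space scale (Gstar_odd m) A1"

end

theory Submission
  imports Defs
begin

text \<open>Killing all generators \<open>e\<^sub>i\<close> maps \<open>G\<^sub>m(\<A>)\<close> onto \<open>\<A>\<^sup>0\<close>: this takes the coefficient of the
  empty monomial, and it is a homomorphism with kernel \<open>G\<^sub>m\<^sup>*(\<A>)\<close>. The kernel is nil, because the
  \<open>(m + 1)\<close>-st power of one of its elements would consist of monomials of length at least \<open>m + 1\<close>
  in \<open>m\<close> generators (\<open>nil_kernel_hom_gcoeff\<close>). The Jacobson radical always contains nil ideals, and
  it is the preimage of the radical of the quotient by such an ideal
  (\<open>nil_left_ideal_subset_maximal\<close>, \<open>jacobson_radical_preimage\<close>). So the radical of \<open>G\<^sub>m(\<A>)\<close>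
  consists of the elements whose coefficient at the empty monomial is in \<open>J\<close>, that is, of
  \<open>J + G\<^sub>m\<^sup>*(\<A>)\<close>.

  To make such identifications immediate, all the spans and tensor products that define \<open>G\<^sub>m(\<A>)\<close> and
  \<open>G\<^sub>m\<^sup>*(\<A>)\<close> are first described by membership conditions on the single coefficients
  (\<open>G_env_coeffs\<close>, \<open>Gstar_env_coeffs\<close>). Sums of such spaces are formed coefficient by coefficient
  (\<open>coeffs_in_plus\<close>), so the decomposition \<open>G\<^sub>m(\<A>) = \<S> + (J + G\<^sub>m\<^sup>*(\<A>))\<close> reduces to
  \<open>\<A>\<^sup>0 = \<S> + J\<close> at the empty monomial and is trivial at all others.\<close>

section \<open>The Jacobson radical of an extension by a nil ideal\<close>

lemma left_ideal_mult: "left_ideal scale B I \<Longrightarrow> b \<in> B \<Longrightarrow> x \<in> I \<Longrightarrow> b * x \<in> I"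
  by (auto simp: left_ideal_def)

lemma subalgebra_mult: "subalgebra scale B \<Longrightarrow> x \<in> B \<Longrightarrow> y \<in> B \<Longrightarrow> x * y \<in> B"
  by (auto simp: subalgebra_def)

lemma (in assoc_algebra) left_ideal_plus:
  assumes "left_ideal scale B I" "left_ideal scale B K" "subalgebra scale B"
  shows "left_ideal scale B (I + K)"
proof -
  have "I + K = {x + y | x y. x \<in> I \<and> y \<in> K}"
    by (auto simp: set_plus_def)
  then have "subspace (I + K)"
    using assms subspace_sums by (simp add: left_ideal_def)
  moreover have "I + K \<subseteq> B"
    using assms subspace_add unfolding left_ideal_def subalgebra_def
    by (blast elim: set_plus_elim)
  moreover have "b * z \<in> I + K" if "b \<in> B" "z \<in> I + K" for b z
    using that assms left_ideal_mult
    by (auto elim!: set_plus_elim simp: distrib_left intro!: set_plus_intro)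
  ultimately show ?thesis
    by (auto simp: left_ideal_def elim!: set_times_elim)
qed

text \<open>If a nil left ideal \<open>K\<close> were not contained in \<open>M\<close>, then \<open>M + K = B\<close>, so a right unit \<open>e\<close>
  modulo \<open>M\<close> would be congruent to some \<open>k \<in> K\<close>. Then \<open>e \<equiv> k \<equiv> k e\<close>, and multiplying this by powers
  of \<open>k\<close> on the left gives \<open>e \<equiv> k\<^sup>n e\<close> for all \<open>n\<close>, hence \<open>e \<in> M\<close>, which forces \<open>M = B\<close>. Algebras
  here need not have a unit, so powers of \<open>k\<close> are written as iterated multiplications.\<close>

lemma (in assoc_algebra) nil_left_ideal_subset_maximal:
  assumes B: "subalgebra scale B"
    and K: "left_ideal scale B K" and nil: "\<And>k. k \<in> K \<Longrightarrow> \<exists>n. ((*) k ^^ n) k = 0"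
    and M: "maximal_left_ideal scale B M" "modular B M"
  shows "K \<subseteq> M"
proof (rule ccontr)
  assume not: "\<not> K \<subseteq> M"
  have lM: "left_ideal scale B M" and ne: "M \<noteq> B"
    and max: "\<And>L. left_ideal scale B L \<Longrightarrow> M \<subseteq> L \<Longrightarrow> L = M \<or> L = B"
    using M(1) by (auto simp: maximal_left_ideal_def)
  have sM: "subspace M" and mult: "\<And>b y. b \<in> B \<Longrightarrow> y \<in> M \<Longrightarrow> b * y \<in> M" and "M \<subseteq> B"
    using lM left_ideal_mult by (auto simp: left_ideal_def)
  have "M \<subseteq> M + K" "K \<subseteq> M + K"
    using lM K subspace_0 by (force simp: left_ideal_def set_plus_def)+
  then have MK: "M + K = B"
    using max[OF left_ideal_plus[OF lM K B]] not by blast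
  obtain e where e: "e \<in> B" "\<And>b. b \<in> B \<Longrightarrow> b - b * e \<in> M"
    using M(2) by (auto simp: modular_def)
  then obtain y k where yk: "e = y + k" "y \<in> M" "k \<in> K"
    using MK by (blast elim: set_plus_elim)
  have "k \<in> B" using yk K by (auto simp: left_ideal_def)
  (* e - k is y, and k - k e is in M because e is a right unit modulo M. *)
  have 0: "e - k * e \<in> M"
    using subspace_add[OF sM yk(2) e(2)[OF \<open>k \<in> B\<close>]] yk(1) by (simp add: algebra_simps)
  have "e - ((*) k ^^ n) k * e \<in> M" for n
  proof (induction n)
    case (Suc n)
    have "(e - k * e) + k * (e - ((*) k ^^ n) k * e) \<in> M"
      using subspace_add[OF sM 0 mult[OF \<open>k \<in> B\<close> Suc]] .
    then show ?case by (simp add: algebra_simps)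
  qed (use 0 in simp)
  moreover obtain n where "((*) k ^^ n) k = 0" using nil yk by blast
  ultimately have "e \<in> M" by (metis diff_zero mult_zero_left)
  then have "b \<in> M" if "b \<in> B" for b
    using subspace_add[OF sM e(2)[OF that] mult[OF that \<open>e \<in> M\<close>]] by simp
  then show False using \<open>M \<subseteq> B\<close> ne by blast
qed

text \<open>The target of the homomorphism is \<open>\<phi> ` B\<close>. That \<open>\<phi>\<close> is defined on the whole ambient algebra
  of \<open>B\<close> saves carrying membership conditions through every computation.\<close>

locale nil_kernel_hom = B: assoc_algebra scaleB + A: assoc_algebra scaleA
  for scaleB :: "'f::field \<Rightarrow> 'b::ring \<Rightarrow> 'b" and scaleA :: "'f \<Rightarrow> 'a::ring \<Rightarrow> 'a" +
  fixes \<phi> :: "'b \<Rightarrow> 'a" and B :: "'b set"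
  assumes subalg: "subalgebra scaleB B"
    and linear: "Vector_Spaces.linear scaleB scaleA \<phi>"
    and mult: "\<phi> (x * y) = \<phi> x * \<phi> y"
    and nil: "x \<in> B \<Longrightarrow> \<phi> x = 0 \<Longrightarrow> \<exists>n. ((*) x ^^ n) x = 0"
begin

interpretation L: Vector_Spaces.linear scaleB scaleA \<phi> by (rule linear)

abbreviation preimage :: "'a set \<Rightarrow> 'b set"
  where "preimage I \<equiv> {x \<in> B. \<phi> x \<in> I}"

lemma left_ideal_preimage:
  assumes "left_ideal scaleA (\<phi> ` B) I"
  shows "left_ideal scaleB B (preimage I)"
proof -
  have "B.subspace (B \<inter> \<phi> -` I)"
    using assms subalg L.subspace_vimage
    by (intro B.subspace_inter) (auto simp: left_ideal_def subalgebra_def)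
  moreover have "preimage I = B \<inter> \<phi> -` I" by auto
  ultimately show ?thesis
    using left_ideal_mult[OF assms] subalgebra_mult[OF subalg]
    by (auto simp: left_ideal_def mult elim!: set_times_elim)
qed

lemma left_ideal_image:
  assumes "left_ideal scaleB B L"
  shows "left_ideal scaleA (\<phi> ` B) (\<phi> ` L)"
proof -
  have "\<phi> b * \<phi> x \<in> \<phi> ` L" if "b \<in> B" "x \<in> L" for b x
    using left_ideal_mult[OF assms that] by (simp flip: mult)
  then show ?thesis
    using assms L.subspace_image by (auto simp: left_ideal_def elim!: set_times_elim)
qed

lemma preimage_image:
  assumes "left_ideal scaleB B L" "preimage {0} \<subseteq> L"
  shows "preimage (\<phi> ` L) = L"
proof -
  have "x \<in> L" if "x \<in> B" "y \<in> L" "\<phi> x = \<phi> y" for x y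
  proof -
    have "x - y \<in> preimage {0}"
      using that assms subalg B.subspace_diff by (auto simp: left_ideal_def subalgebra_def L.diff)
    then show "x \<in> L"
      using that assms B.subspace_add[of L "x - y" y] by (auto simp: left_ideal_def)
  qed
  then show ?thesis using assms by (auto simp: left_ideal_def)
qed

lemma preimage_zero_subset:
  assumes "left_ideal scaleA (\<phi> ` B) I"
  shows "preimage {0} \<subseteq> preimage I"
  using assms A.subspace_0 by (auto simp: left_ideal_def)

lemma modular_preimage:
  "modular (\<phi> ` B) I \<longleftrightarrow> modular B (preimage I)"
proof -
  have "b - b * e \<in> B" if "b \<in> B" "e \<in> B" for b e
    using that subalg B.subspace_diff subalgebra_mult by (auto simp: subalgebra_def)
  then show ?thesis
    by (auto simp: modular_def L.diff mult)
qed

lemma image_preimage: "I \<subseteq> \<phi> ` B \<Longrightarrow> \<phi> ` preimage I = I"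
  by auto

lemma maximal_preimage:
  assumes "maximal_left_ideal scaleA (\<phi> ` B) I"
  shows "maximal_left_ideal scaleB B (preimage I)"
proof -
  have I: "left_ideal scaleA (\<phi> ` B) I" and ne: "I \<noteq> \<phi> ` B"
    and max: "\<And>L. left_ideal scaleA (\<phi> ` B) L \<Longrightarrow> I \<subseteq> L \<Longrightarrow> L = I \<or> L = \<phi> ` B"
    using assms by (auto simp: maximal_left_ideal_def)
  have sub: "I \<subseteq> \<phi> ` B" using I by (simp add: left_ideal_def)
  have "preimage I \<noteq> B" using ne image_preimage[OF sub] by metis
  moreover have "K = preimage I \<or> K = B" if K: "left_ideal scaleB B K" "preimage I \<subseteq> K" for K
  proof -
    have "I \<subseteq> \<phi> ` K" using K(2) image_preimage[OF sub] by blast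
    then have "\<phi> ` K = I \<or> \<phi> ` K = \<phi> ` B" using max left_ideal_image[OF K(1)] by blast
    moreover have "preimage (\<phi> ` K) = K"
      using preimage_image[OF K(1)] preimage_zero_subset[OF I] K(2) by blast
    moreover have "preimage (\<phi> ` B) = B" by auto
    ultimately show ?thesis by metis
  qed
  ultimately show ?thesis
    using left_ideal_preimage[OF I] by (auto simp: maximal_left_ideal_def)
qed

lemma maximal_image:
  assumes "maximal_left_ideal scaleB B M" "preimage {0} \<subseteq> M"
  shows "maximal_left_ideal scaleA (\<phi> ` B) (\<phi> ` M)"
proof -
  have M: "left_ideal scaleB B M" and ne: "M \<noteq> B"
    and max: "\<And>L. left_ideal scaleB B L \<Longrightarrow> M \<subseteq> L \<Longrightarrow> L = M \<or> L = B"
    using assms by (auto simp: maximal_left_ideal_def)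
  have MM: "preimage (\<phi> ` M) = M" using preimage_image[OF M assms(2)] .
  have "preimage (\<phi> ` B) = B" by auto
  then have "\<phi> ` M \<noteq> \<phi> ` B" using ne MM by metis
  moreover have "I = \<phi> ` M \<or> I = \<phi> ` B" if I: "left_ideal scaleA (\<phi> ` B) I" "\<phi> ` M \<subseteq> I" for I
  proof -
    have "M \<subseteq> preimage I" using I(2) M by (auto simp: left_ideal_def)
    then have "preimage I = M \<or> preimage I = B" using max left_ideal_preimage[OF I(1)] by blast
    moreover have "\<phi> ` preimage I = I" using I(1) by (intro image_preimage) (simp add: left_ideal_def)
    ultimately show ?thesis by metis
  qed
  ultimately show ?thesis
    using left_ideal_image[OF M] by (auto simp: maximal_left_ideal_def)
qed

text \<open>The maximal modular left ideals of \<open>B\<close> contain the kernel, because it is nil; so they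
  are exactly the preimages of those of the image of \<open>\<phi>\<close>.\<close>

theorem jacobson_radical_preimage:
  "jacobson_radical scaleB B = preimage (jacobson_radical scaleA (\<phi> ` B))"
proof (intro equalityI subsetI)
  fix x assume x: "x \<in> jacobson_radical scaleB B"
  have "\<phi> x \<in> I" if "maximal_left_ideal scaleA (\<phi> ` B) I" "modular (\<phi> ` B) I" for I
    using x maximal_preimage[OF that(1)] that(2) by (auto simp: jacobson_radical_def modular_preimage)
  then show "x \<in> preimage (jacobson_radical scaleA (\<phi> ` B))"
    using x by (auto simp: jacobson_radical_def)
next
  fix x assume x: "x \<in> preimage (jacobson_radical scaleA (\<phi> ` B))"
  have "x \<in> M" if M: "maximal_left_ideal scaleB B M" "modular B M" for M
  proof -
    have lM: "left_ideal scaleB B M" using M by (simp add: maximal_left_ideal_def)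
    have "left_ideal scaleA (\<phi> ` B) {0}"
      using subalg B.subspace_0 by (force simp: left_ideal_def subalgebra_def elim!: set_times_elim)
    then have ker: "preimage {0} \<subseteq> M"
      using nil M by (intro B.nil_left_ideal_subset_maximal[OF subalg] left_ideal_preimage) auto
    have MM: "preimage (\<phi> ` M) = M" using preimage_image[OF lM ker] .
    then have "modular (\<phi> ` B) (\<phi> ` M)" using M(2) by (simp add: modular_preimage)
    then have "\<phi> x \<in> \<phi> ` M"
      using x maximal_image[OF M(1) ker] by (auto simp: jacobson_radical_def)
    then show "x \<in> M" using x MM by blast
  qed
  then show "x \<in> jacobson_radical scaleB B"
    using x by (auto simp: jacobson_radical_def)
qed

end


section \<open>Coefficientwise description of Grassmann envelopes\<close>

text \<open>The family \<open>V\<close> may also prescribe the monomials that occur: \<open>V I = {0}\<close> excludes \<open>e\<^sub>I\<close>.\<close>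

definition coeffs_in :: "(nat set \<Rightarrow> 'a::zero set) \<Rightarrow> 'a grassmann set"
  where "coeffs_in V = {x. \<forall>I. gcoeff x I \<in> V I}"

lemma (in vector_space) subspace_coeffs_in:
  assumes "\<And>I. subspace (V I)"
  shows "module.subspace (gscale scale) (coeffs_in V)"
proof -
  interpret G: vector_space "gscale scale" by (rule vector_space_gscale)
  show ?thesis
    using assms by (auto simp: G.subspace_def coeffs_in_def gcoeff_gscale subspace_0
        intro: subspace_add subspace_scale)
qed

text \<open>By the expansion in terms \<open>e\<^sub>I \<otimes> a\<close>, a space of elements given by conditions on the single
  coefficients is generated by the terms in it.\<close>

lemma coeffs_in_induct [consumes 1, case_names zero add gterm]:
  fixes x :: "'a::ab_group_add grassmann"
  assumes "x \<in> coeffs_in V"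
    and "P 0" "\<And>y z. P y \<Longrightarrow> P z \<Longrightarrow> P (y + z)"
    and "\<And>I a. finite I \<Longrightarrow> a \<in> V I \<Longrightarrow> P (gterm I a)"
  shows "P x"
proof -
  have "P (\<Sum>I\<in>T. gterm I (gcoeff x I))" if "\<And>I. I \<in> T \<Longrightarrow> finite I" for T
    using that
  proof (induction T rule: infinite_finite_induct)
    case (insert I T)
    then show ?case using assms by (auto simp: coeffs_in_def)
  qed (use assms in auto)
  moreover have "finite I" if "I \<in> {I. gcoeff x I \<noteq> 0}" for I
    using that gcoeff_infinite[of I x] by auto
  ultimately have "P (\<Sum>I | gcoeff x I \<noteq> 0. gterm I (gcoeff x I))" .
  then show ?thesis
    by (subst grassmann_expansion[of x])
qed

text \<open>Coefficientwise splittings of an element need not have finite support, but splitting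
  its terms one at a time ensures this.\<close>

lemma (in vector_space) coeffs_in_plus:
  assumes V: "\<And>I. subspace (V I)" and W: "\<And>I. subspace (W I)"
    and U: "\<And>I. V I + W I = U I"
  shows "coeffs_in V + coeffs_in W = coeffs_in U"
  unfolding U[symmetric]
proof (intro equalityI subsetI)
  fix x assume "x \<in> coeffs_in (\<lambda>I. V I + W I)"
  then show "x \<in> coeffs_in V + coeffs_in W"
  proof (induction rule: coeffs_in_induct)
    case zero
    have "0 \<in> coeffs_in V" "0 \<in> coeffs_in W" using V W subspace_0 by (auto simp: coeffs_in_def)
    then show ?case by (metis add_0 set_plus_intro)
  next
    case (add y z)
    then obtain y1 y2 z1 z2 where *: "y = y1 + y2" "z = z1 + z2"
      "y1 \<in> coeffs_in V" "y2 \<in> coeffs_in W" "z1 \<in> coeffs_in V" "z2 \<in> coeffs_in W"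
      by (auto elim!: set_plus_elim)
    then have "(y1 + z1) + (y2 + z2) \<in> coeffs_in V + coeffs_in W"
      using V W subspace_add by (intro set_plus_intro) (auto simp: coeffs_in_def)
    then show ?case using * by (simp add: algebra_simps)
  next
    case (gterm I a)
    then obtain v w where "a = v + w" "v \<in> V I" "w \<in> W I" by (auto elim!: set_plus_elim)
    then show ?case
      using V W subspace_0 by (auto simp: gterm_add coeffs_in_def gcoeff_gterm intro!: set_plus_intro)
  qed
next
  fix x assume "x \<in> coeffs_in V + coeffs_in W"
  then obtain v w where "x = v + w" "v \<in> coeffs_in V" "w \<in> coeffs_in W"
    by (rule set_plus_elim)
  then show "x \<in> coeffs_in (\<lambda>I. V I + W I)"
    by (simp add: coeffs_in_def set_plus_intro)
qed

lemma (in vector_space) gtensor_one_image: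
  assumes "0 \<in> V"
  shows "gtensor scale 1 ` V = coeffs_in (\<lambda>I. if I = {} then V else {0})"
proof (intro equalityI subsetI)
  fix x assume "x \<in> coeffs_in (\<lambda>I. if I = {} then V else {0})"
  then have *: "gcoeff x I \<in> (if I = {} then V else {0})" for I
    by (simp add: coeffs_in_def)
  have "x = gtensor scale 1 (gcoeff x {})"
  proof (rule grassmann_eqI)
    fix I
    show "gcoeff x I = gcoeff (gtensor scale 1 (gcoeff x {})) I"
      using *[of I] by (cases "I = {}") (simp_all add: gcoeff_gtensor one_grassmann_def gcoeff_gterm)
  qed
  then show "x \<in> gtensor scale 1 ` V" using *[of "{}"] by auto
qed (use assms in \<open>auto simp: coeffs_in_def gcoeff_gtensor one_grassmann_def gcoeff_gterm
      split: if_splits\<close>)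

text \<open>A word with a repeated letter vanishes, and any other can be sorted at the cost of a sign. So
  words and the basis monomials \<open>e\<^sub>I\<close> of the same lengths have the same span.\<close>

lemma prod_gen_cases:
  "prod_list (map gen is) = (0 :: 'a::ring_1 grassmann) \<or>
    distinct is \<and> (\<exists>k. prod_list (map gen is) = (gterm (set is) (signed k 1) :: 'a grassmann))"
proof (induction "is")
  case Nil
  then show ?case by (auto simp: one_grassmann_def intro: exI[of _ 0])
next
  case (Cons i "is")
  then show ?case by (auto simp: gen_def gterm_mult signed_mult)
qed

lemma span_prod_gen:
  "module.span fscale {prod_list (map gen is) | is. set is \<subseteq> {1..m} \<and> P (length is)} =
    (coeffs_in (\<lambda>I. if I \<subseteq> {1..m} \<and> P (card I) then UNIV else {0}) :: 'f::field grassmann set)"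
    (is "module.span fscale ?W = coeffs_in ?V")
proof -
  interpret F: vector_space "(*) :: 'f \<Rightarrow> 'f \<Rightarrow> 'f" by (rule vector_space_field)
  interpret G: vector_space "fscale :: 'f \<Rightarrow> 'f grassmann \<Rightarrow> 'f grassmann"
    by (rule F.vector_space_gscale)
  have "?W \<subseteq> coeffs_in ?V"
  proof
    fix w assume "w \<in> ?W"
    then obtain "is" where "is": "w = prod_list (map gen is)" "set is \<subseteq> {1..m}" "P (length is)"
      by blast
    then show "w \<in> coeffs_in ?V"
      using prod_gen_cases[of "is", where 'a = 'f]
      by (auto simp: coeffs_in_def gcoeff_gterm distinct_card split: if_splits)
  qed
  moreover have "F.subspace (?V I)" for I
    by (auto simp: F.subspace_UNIV F.subspace_single_0)
  then have "G.subspace (coeffs_in ?V)" by (rule F.subspace_coeffs_in)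
  ultimately have "G.span ?W \<subseteq> coeffs_in ?V" by (rule G.span_minimal)
  moreover have "x \<in> G.span ?W" if "x \<in> coeffs_in ?V" for x
    using that
  proof (induction rule: coeffs_in_induct)
    case (gterm I a)
    show ?case
    proof (cases "a = 0")
      case False
      let ?is = "sorted_list_of_set I"
      have I: "I \<subseteq> {1..m}" "P (card I)" using gterm False by (auto split: if_splits)
      have "prod_list (map gen ?is) = (gterm I 1 :: 'f grassmann)"
        using gterm by (subst prod_gen_sorted) auto
      then have "gterm I 1 \<in> ?W"
        using I gterm by (force intro: exI[of _ ?is])
      moreover have "gterm I a = fscale a (gterm I 1)"
        by (rule grassmann_eqI) (simp add: F.gcoeff_gscale gcoeff_gterm)
      ultimately show ?thesis by (simp add: G.span_base G.span_scale)
    qed (simp add: G.span_zero)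
  qed (auto intro: G.span_zero G.span_add)
  ultimately show ?thesis by blast
qed

lemma (in vector_space) tensor_space_coeffs_in:
  assumes "subspace U"
  shows "tensor_space scale (coeffs_in (\<lambda>I. if Q I then UNIV else {0})) U =
    coeffs_in (\<lambda>I. if Q I then U else {0})" (is "?T = coeffs_in ?V")
proof -
  interpret G: vector_space "gscale scale" by (rule vector_space_gscale)
  have "{gtensor scale g a | g a. g \<in> coeffs_in (\<lambda>I. if Q I then UNIV else {0}) \<and> a \<in> U}
      \<subseteq> coeffs_in ?V"
    using assms by (auto simp: coeffs_in_def gcoeff_gtensor intro: subspace_scale split: if_splits)
  moreover have "G.subspace (coeffs_in ?V)"
    using assms subspace_single_0 by (intro subspace_coeffs_in) auto
  ultimately have "?T \<subseteq> coeffs_in ?V"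
    unfolding tensor_space_def by (rule G.span_minimal)
  moreover have "x \<in> ?T" if "x \<in> coeffs_in ?V" for x
    using that
  proof (induction rule: coeffs_in_induct)
    case (gterm I a)
    show ?case
    proof (cases "a = 0")
      case False
      then have "Q I" "a \<in> U" using gterm by (auto split: if_splits)
      moreover from this have "gterm I 1 \<in> coeffs_in (\<lambda>I. if Q I then UNIV else {0})"
        by (auto simp: coeffs_in_def gcoeff_gterm)
      ultimately show ?thesis
        unfolding tensor_space_def gterm_conv_gtensor[of I a] by (intro G.span_base) blast
    qed (simp add: tensor_space_def G.span_zero)
  qed (auto simp: tensor_space_def intro: G.span_zero G.span_add)
  ultimately show ?thesis by blast
qed

definition env_coeffs :: "'a::zero set \<Rightarrow> 'a set \<Rightarrow> nat \<Rightarrow> nat set \<Rightarrow> 'a set"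
  where "env_coeffs A0 A1 m I =
    (if I \<subseteq> {1..m} then if even (card I) then A0 else A1 else {0})"

context vector_space
begin

lemma G_env_coeffs:
  assumes "subspace A0" "subspace A1"
  shows "G_env scale A0 A1 m = coeffs_in (env_coeffs A0 A1 m)"
proof -
  have "G_env scale A0 A1 m = coeffs_in (\<lambda>I. if I \<subseteq> {1..m} \<and> even (card I) then A0 else {0}) +
      coeffs_in (\<lambda>I. if I \<subseteq> {1..m} \<and> odd (card I) then A1 else {0})"
    unfolding G_env_def G_even_def G_odd_def
      span_prod_gen[where P = even] span_prod_gen[where P = "\<lambda>l. odd l"]
    using assms by (simp only: tensor_space_coeffs_in)
  also have "\<dots> = coeffs_in (env_coeffs A0 A1 m)"
    using assms
    by (intro coeffs_in_plus) (simp_all add: subspace_single_0 env_coeffs_def)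
  finally show ?thesis .
qed

lemma Gstar_env_coeffs:
  assumes "subspace A0" "subspace A1"
  shows "Gstar_env scale A0 A1 m =
    coeffs_in (\<lambda>I. if I = {} then {0} else env_coeffs A0 A1 m I)"
proof -
  have "Gstar_env scale A0 A1 m =
      coeffs_in (\<lambda>I. if I \<subseteq> {1..m} \<and> card I > 0 \<and> even (card I) then A0 else {0}) +
      coeffs_in (\<lambda>I. if I \<subseteq> {1..m} \<and> card I > 0 \<and> odd (card I) then A1 else {0})"
    unfolding Gstar_env_def Gstar_even_def Gstar_odd_def
      span_prod_gen[where P = "\<lambda>l. l > 0 \<and> even l"] span_prod_gen[where P = "\<lambda>l. l > 0 \<and> odd l"]
    using assms by (simp only: tensor_space_coeffs_in)
  also have "\<dots> = coeffs_in (\<lambda>I. if I = {} then {0} else env_coeffs A0 A1 m I)"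
    using assms
    by (intro coeffs_in_plus)
      (auto simp: subspace_single_0 env_coeffs_def card_gt_0_iff finite_subset simp del: One_nat_def)
  finally show ?thesis .
qed

end


section \<open>The radical of a Grassmann envelope\<close>

lemma gcoeff_mult_empty: "gcoeff (x * y) {} = gcoeff x {} * gcoeff (y :: 'a::ring grassmann) {}"
  by (simp add: times_grassmann.rep_eq)

lemma (in assoc_algebra) subspace_env_coeffs:
  assumes "z2_grading scale A0 A1"
  shows "subspace (env_coeffs A0 A1 m I)"
  using assms by (auto simp: z2_grading_def env_coeffs_def subspace_single_0)

text \<open>The lengths of \<open>e\<^sub>I\<close> and \<open>e\<^bsub>K - I\<^esub>\<close> add up to that of \<open>e\<^sub>K\<close>, so their parities add in the same
  way as the degrees of the grading.\<close>

lemma env_coeffs_mult: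
  assumes "z2_grading scale A0 A1" "I \<subseteq> K"
    "a \<in> env_coeffs A0 A1 m I" "b \<in> env_coeffs A0 A1 m (K - I)"
  shows "a * b \<in> env_coeffs A0 A1 m K"
proof (cases "I \<subseteq> {1..m} \<and> K - I \<subseteq> {1..m}")
  case True
  then have K: "K \<subseteq> {1..m}" "finite K" by (auto intro: finite_subset)
  then have "card K = card I + card (K - I)"
    using assms(2) by (metis card_Diff_subset card_mono finite_subset le_add_diff_inverse)
  then show ?thesis
    using assms K True unfolding z2_grading_def env_coeffs_def
    by (auto split: if_splits intro: set_times_intro)
next
  case False
  then have "a = 0 \<or> b = 0" using assms(3,4) unfolding env_coeffs_def by (metis singletonD)
  then have "a * b = 0" by auto
  moreover have "0 \<in> env_coeffs A0 A1 m K"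
    using assms(1) by (auto simp: z2_grading_def env_coeffs_def)
  ultimately show ?thesis by simp
qed

lemma (in assoc_algebra) subalgebra_coeffs_in_env:
  assumes "z2_grading scale A0 A1"
  shows "subalgebra (gscale scale) (coeffs_in (env_coeffs A0 A1 m))"
proof -
  note sub = subspace_env_coeffs[OF assms]
  have signed: "signed k a \<in> U" if "subspace U" "a \<in> U" for k a U
    using that by (simp add: signed_def subspace_neg)
  have "x * y \<in> coeffs_in (env_coeffs A0 A1 m)"
    if "x \<in> coeffs_in (env_coeffs A0 A1 m)" "y \<in> coeffs_in (env_coeffs A0 A1 m)" for x y
  proof -
    have "gcoeff x L * gcoeff y (I - L) \<in> env_coeffs A0 A1 m I" if "L \<in> Pow I" for L I
      using env_coeffs_mult[OF assms, of L I] \<open>x \<in> _\<close> \<open>y \<in> _\<close> that by (auto simp: coeffs_in_def)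
    then show ?thesis
      unfolding coeffs_in_def times_grassmann.rep_eq mem_Collect_eq
      by (intro allI subspace_sum sub signed)
  qed
  then show ?thesis
    using subspace_coeffs_in[OF sub] by (auto simp: subalgebra_def elim!: set_times_elim)
qed

text \<open>Without a term of length zero, every factor raises the length of the monomials that
  occur in a power.\<close>

lemma gcoeff_power_short:
  fixes x :: "'a::ring grassmann"
  assumes "gcoeff x {} = 0" "card I \<le> n"
  shows "gcoeff (((*) x ^^ n) x) I = 0"
  using assms(2)
proof (induction n arbitrary: I)
  case 0
  then show ?case using assms(1) by (cases "finite I") (auto simp: gcoeff_infinite)
next
  case (Suc n)
  have "gcoeff x L * gcoeff (((*) x ^^ n) x) (I - L) = 0" if "L \<subseteq> I" for L
  proof (cases "L = {} \<or> infinite I")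
    case True
    then show ?thesis
      using assms(1) that Suc.IH[of "I - L"]
      by (metis finite_Diff2 gcoeff_infinite mult_zero_left mult_zero_right)
  next
    case False
    then have "card (I - L) < card I"
      using that by (intro psubset_card_mono) auto
    then show ?thesis using Suc by simp
  qed
  then show ?case by (simp add: times_grassmann.rep_eq)
qed

text \<open>Elements of the kernel satisfy \<open>x\<^bsup>m+1\<^esup> = 0\<close>: their \<open>(m + 1)\<close>-st power has no terms of length at
  most \<open>m\<close>, and there are no longer monomials in \<open>m\<close> generators.\<close>

lemma (in assoc_algebra) nil_kernel_hom_gcoeff:
  assumes "z2_grading scale A0 A1"
  shows "nil_kernel_hom (gscale scale) scale (\<lambda>x. gcoeff x {}) (coeffs_in (env_coeffs A0 A1 m))"
proof -
  let ?B = "coeffs_in (env_coeffs A0 A1 m)"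
  note subalg = subalgebra_coeffs_in_env[OF assms]
  have "\<exists>n. ((*) x ^^ n) x = 0" if x: "x \<in> ?B" "gcoeff x {} = 0" for x
  proof (intro exI grassmann_eqI)
    fix I
    have pow: "((*) x ^^ n) x \<in> ?B" for n
      using x subalg by (induction n) (auto intro: subalgebra_mult)
    show "gcoeff (((*) x ^^ m) x) I = gcoeff 0 I"
    proof (cases "I \<subseteq> {1..m}")
      case True
      then have "card I \<le> m" using card_mono[of "{1..m}" I] by simp
      then show ?thesis using gcoeff_power_short[OF x(2)] by simp
    next
      case False
      moreover have "gcoeff (((*) x ^^ m) x) I \<in> env_coeffs A0 A1 m I"
        using pow[of m] by (simp add: coeffs_in_def)
      ultimately show ?thesis by (simp add: env_coeffs_def del: One_nat_def)
    qed
  qed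
  moreover have "Vector_Spaces.linear (gscale scale) scale (\<lambda>x. gcoeff x {})"
    using vector_space_gscale vector_space_axioms
    by (simp add: Vector_Spaces.linear_iff gcoeff_gscale)
  ultimately show ?thesis
    using assoc_algebra_gscale assoc_algebra_axioms subalg
    by (simp add: nil_kernel_hom_def nil_kernel_hom_axioms_def gcoeff_mult_empty)
qed

theorem proposition1:
  fixes scale :: "'f::{alg_closed_field, field_char_0} \<Rightarrow> 'a::ring \<Rightarrow> 'a"
    and A0 A1 S J :: "'a set" and m :: nat
  assumes "assoc_algebra scale"
    and "finite_dimensional scale"
    and "z2_grading scale A0 A1"
    and "semisimple_subalgebra scale S"
    and "J = jacobson_radical scale A0"
    and "A0 = S + J"
    and "S \<inter> J = {0}"
    and "m \<ge> 1"
  defines "emb \<equiv> gtensor scale 1"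
  shows "G_env scale A0 A1 m = emb ` S + (emb ` J + Gstar_env scale A0 A1 m)
    \<and> jacobson_radical (gscale scale) (G_env scale A0 A1 m) = emb ` J + Gstar_env scale A0 A1 m"
proof -
  interpret assoc_algebra scale by fact
  have A: "subspace A0" "subspace A1" using assms(3) by (auto simp: z2_grading_def)
  have S: "subspace S" using assms(4) by (simp add: semisimple_subalgebra_def subalgebra_def)
  have "J = A0 \<inter> \<Inter>{I. maximal_left_ideal scale A0 I \<and> modular A0 I}"
    using assms(5) by (simp add: jacobson_radical_def)
  then have J: "subspace J"
    using A by (auto simp: maximal_left_ideal_def left_ideal_def intro!: subspace_inter subspace_Inter)
  have JA: "J \<subseteq> A0" using assms(5) by (auto simp: jacobson_radical_def)
  let ?E = "env_coeffs A0 A1 m"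
  let ?N = "\<lambda>I. if I = {} then J else ?E I"
  note env = subspace_env_coeffs[OF assms(3)]
  have emb: "emb ` U = coeffs_in (\<lambda>I. if I = {} then U else {0})" if "subspace U" for U
    unfolding emb_def by (rule gtensor_one_image) (use that subspace_0 in auto)
  have N: "emb ` J + Gstar_env scale A0 A1 m = coeffs_in ?N"
    unfolding emb[OF J] Gstar_env_coeffs[OF A]
    using J env by (intro coeffs_in_plus) (simp_all add: subspace_single_0)
  have E0: "?E {} = A0" by (simp add: env_coeffs_def)
  have "emb ` S + coeffs_in ?N = coeffs_in ?E"
    unfolding emb[OF S]
    using J S env E0 assms(6) by (intro coeffs_in_plus) (simp_all add: subspace_single_0)
  moreover interpret nil_kernel_hom "gscale scale" scale "\<lambda>x. gcoeff x {}" "coeffs_in ?E"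
    by (rule nil_kernel_hom_gcoeff[OF assms(3)])
  have "(\<lambda>x. gcoeff x {}) ` coeffs_in ?E = A0"
  proof (intro equalityI subsetI)
    fix a assume "a \<in> A0"
    then have "gterm {} a \<in> coeffs_in ?E"
      using env E0 by (auto simp: coeffs_in_def gcoeff_gterm subspace_0)
    then show "a \<in> (\<lambda>x. gcoeff x {}) ` coeffs_in ?E"
      by (rule rev_image_eqI) (simp add: gcoeff_gterm)
  qed (use E0 in \<open>auto simp: coeffs_in_def\<close>)
  then have "jacobson_radical (gscale scale) (coeffs_in ?E) = preimage J"
    using jacobson_radical_preimage assms(5) by simp
  moreover have "preimage J = coeffs_in ?N"
    using E0 JA by (auto simp: coeffs_in_def split: if_splits)
  ultimately show ?thesis
    by (simp add: N G_env_coeffs[OF A])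
qed

end
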